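(* For every $d\in\mathbb N$ and every real $0<\delta\le 1$, \[ N_{[]}(d,\delta)\ge\left\lceil \delta^{-d}\right\rceil,\qquad N(d,\delta)\ge\left\lceil \frac{d!}{d^d}\,\delta^{-d}\right\rceil . \]
   Context: For $\boldsymbol x=(x_1,\dots,x_d)\in[0,1]^d$ put $V(\boldsymbol x)=\prod_{j=1}^d x_j$; $\boldsymbol x\le\boldsymbol y$ means $x_j\le y_j$ for all $j$. If $\boldsymbol x\le\boldsymbol y$ in $[0,1]^d$, the box $[\boldsymbol x,\boldsymbol y]=\prod_{j=1}^d[x_j,y_j]$ is a $\delta$-bracket when $V(\boldsymbol y)-V(\boldsymbol x)\le\delta$. A $\delta$-bracketing cover is a finite family of $\delta$-brackets whose union is $[0,1]^d$; $N_{[]}(d,\delta)$ is its minimum possible cardinality. A finite set $\Gamma\subset[0,1]^d$ is a $\delta$-cover if for every $\boldsymbol z\in[0,1]^d$ there are $\boldsymbol x,\boldsymbol y\in\Gamma\cup\{\boldsymbol 0\}$ with $\boldsymbol x\le\boldsymbol z\le\boldsymbol y$ and $V(\boldsymbol y)-V(\boldsymbol x)\le\delta$; $N(d,\delta)$ is the minimum cardinality $|\Gamma|$ of a $\delta$-cover. *)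

theory Defs
  imports "HOL-Analysis.Analysis"
begin

text \<open>
  Points of \<open>[0,1]\<^sup>d\<close> are elements of \<open>{0..1} :: (real ^ 'd) set\<close> with \<open>d = CARD('d) \<ge> 1\<close>; on
  \<open>real ^ 'd\<close> the constants \<open>0\<close> and \<open>1\<close> are the constant vectors and \<open>\<le>\<close> is the componentwise
  order, so \<open>{x..y}\<close> is the box \<open>\<Prod>\<^sub>j [x\<^sub>j, y\<^sub>j]\<close>.
\<close>

definition anchored_vol :: "real ^ 'd \<Rightarrow> real" where
  "anchored_vol x = (\<Prod>j\<in>UNIV. x $ j)"

definition bracket :: "real \<Rightarrow> (real ^ 'd) set \<Rightarrow> bool" where
  "bracket \<delta> B \<longleftrightarrow>
     (\<exists>x\<in>{0..1}. \<exists>y\<in>{0..1}. x \<le> y \<and> B = {x..y} \<and> anchored_vol y - anchored_vol x \<le> \<delta>)"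

definition bracketing_cover :: "real \<Rightarrow> (real ^ 'd) set set \<Rightarrow> bool" where
  "bracketing_cover \<delta> \<B> \<longleftrightarrow> finite \<B> \<and> (\<forall>B\<in>\<B>. bracket \<delta> B) \<and> \<Union>\<B> = {0..1}"

definition delta_cover :: "real \<Rightarrow> (real ^ 'd) set \<Rightarrow> bool" where
  "delta_cover \<delta> \<Gamma> \<longleftrightarrow> finite \<Gamma> \<and> \<Gamma> \<subseteq> {0..1} \<and>
     (\<forall>z\<in>{0..1}. \<exists>x\<in>\<Gamma> \<union> {0}. \<exists>y\<in>\<Gamma> \<union> {0}.
        x \<le> z \<and> z \<le> y \<and> anchored_vol y - anchored_vol x \<le> \<delta>)"

text \<open>
  The dimension is passed as a type argument. Finite covers exist for every \<open>\<delta> > 0\<close>, so the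
  minima below are attained there; for other \<open>\<delta>\<close> the \<open>LEAST\<close> terms may be unspecified.
\<close>

definition bracketing_number :: "'d::finite itself \<Rightarrow> real \<Rightarrow> nat" where
  "bracketing_number TYPE('d) \<delta> =
     (LEAST n. \<exists>\<B> :: (real ^ 'd) set set. bracketing_cover \<delta> \<B> \<and> card \<B> = n)"

definition covering_number :: "'d::finite itself \<Rightarrow> real \<Rightarrow> nat" where
  "covering_number TYPE('d) \<delta> =
     (LEAST n. \<exists>\<Gamma> :: (real ^ 'd) set. delta_cover \<delta> \<Gamma> \<and> card \<Gamma> = n)"

end

theory Submission
  imports Defs
begin

text \<open>
  Write \<open>d = CARD('d)\<close> and \<open>V\<close> for \<open>anchored_vol\<close>. Both bounds are covering arguments by
  volume, but Lebesgue measure on the cube itself is the wrong volume: for \<open>d = 2\<close> and small \<open>\<delta>\<close> the bracket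
  \<open>[0,1] \<times> [0,\<delta>]\<close> is much larger than \<open>\<delta>\<^sup>2\<close>. The right choice is the product measure with
  density \<open>d\<^sup>d V(x)\<^bsup>d-1\<^esup>\<close>, which gives \<open>[x,y]\<close> the mass \<open>\<Prod>\<^sub>j (y\<^sub>j\<^sup>d - x\<^sub>j\<^sup>d)\<close> and the cube the mass \<open>1\<close>.
  Equivalently, and this is how it is done below, points are measured by Lebesgue measure after
  the coordinate change \<open>u\<^sub>j = x\<^sub>j\<^sup>d\<close>. In the new coordinates \<open>V\<close> becomes the geometric mean of
  the \<open>u\<^sub>j\<close>, so that inequalities on means apply.

  \<^item> Superadditivity of the geometric mean reads
    \<open>\<Prod>\<^sub>j (y\<^sub>j\<^sup>d - x\<^sub>j\<^sup>d) \<le> (V(y) - V(x))\<^sup>d\<close> (\<open>prod_diff_powers_le\<close>). Every \<open>\<delta>\<close>-bracket therefore has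
    mass at most \<open>\<delta>\<^sup>d\<close>, and at least \<open>\<delta>\<^bsup>-d\<^esup>\<close> of them are needed.

  \<^item> In a \<open>\<delta>\<close>-cover each point \<open>z\<close> lies below some \<open>y\<close> in \<open>\<Gamma>\<close> or \<open>y = 0\<close> with
    \<open>V(y) - V(z) \<le> \<delta>\<close>. Here the inequality between geometric and arithmetic mean bounds
    \<open>\<Sum>\<^sub>j (1 - z\<^sub>j\<^sup>d / y\<^sub>j\<^sup>d)\<close> by \<open>d \<delta> / V(y)\<close>. In the new coordinates this confines the points
    attached to \<open>y\<close> to a right-angled simplex with corner at the image of \<open>y\<close>, and the factors \<open>V(y)\<^sup>d\<close>
    cancel in its volume \<open>d\<^sup>d \<delta>\<^sup>d / d!\<close>. The point \<open>y = 0\<close> is responsible for a null set only, so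
    \<open>|\<Gamma>|\<close> is at least \<open>d! / d\<^sup>d \<cdot> \<delta>\<^bsup>-d\<^esup>\<close>.

  The two covering numbers are minima, which obey these bounds because they are attained; for
  this it is enough that some finite cover exists, and a sufficiently fine grid is one.
\<close>

section \<open>Inequalities between products and means\<close>

text \<open>
  The inequality between arithmetic and geometric mean, without roots. After scaling to mean \<open>1\<close>
  it follows by multiplying \<open>t \<le> exp (t - 1)\<close> over all entries, since the exponents add up to \<open>0\<close>.
\<close>

lemma prod_le_mean_power:
  fixes t :: "'i \<Rightarrow> real"
  assumes "finite I" and t: "\<And>i. i \<in> I \<Longrightarrow> 0 \<le> t i"
  shows "(\<Prod>i\<in>I. t i) \<le> (sum t I / card I) ^ card I"
proof (cases "sum t I = 0")
  case True
  then have "\<forall>i\<in>I. t i = 0"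
    using assms by (simp add: sum_nonneg_eq_0_iff)
  then show ?thesis
    using True by (cases "I = {}") (auto simp: zero_power prod_zero_iff \<open>finite I\<close> card_gt_0_iff)
next
  case False
  define A where "A = sum t I / card I"
  have "I \<noteq> {}" using False by auto
  then have card: "real (card I) > 0"
    using \<open>finite I\<close> by (simp add: card_gt_0_iff)
  have "sum t I > 0"
    using False sum_nonneg[of I t] t by force
  then have A: "A > 0" using card by (simp add: A_def)
  have "(\<Prod>i\<in>I. t i / A) \<le> (\<Prod>i\<in>I. exp (t i / A - 1))"
  proof (rule prod_mono, intro conjI)
    fix i assume "i \<in> I"
    then show "0 \<le> t i / A" using t A by simp
    show "t i / A \<le> exp (t i / A - 1)"
      using exp_ge_add_one_self[of "t i / A - 1"] by simp
  qed
  also have "\<dots> = exp (sum t I / A - card I)"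
    using \<open>finite I\<close> by (simp add: exp_sum[symmetric] sum_subtractf sum_divide_distrib)
  also have "sum t I / A - card I = 0"
    using False card by (simp add: A_def)
  finally have "(\<Prod>i\<in>I. t i) / A ^ card I \<le> 1"
    by (simp add: prod_dividef)
  then show ?thesis
    using A by (simp add: A_def[symmetric] divide_le_eq)
qed

lemma prod_le_mean_of_powers:
  fixes t :: "'i \<Rightarrow> real"
  assumes "finite I" "I \<noteq> {}" and t: "\<And>i. i \<in> I \<Longrightarrow> 0 \<le> t i"
  shows "(\<Prod>i\<in>I. t i) \<le> (\<Sum>i\<in>I. t i ^ card I) / card I"
proof -
  have "(\<Prod>i\<in>I. t i) ^ card I \<le> ((\<Sum>i\<in>I. t i ^ card I) / card I) ^ card I"
    using prod_le_mean_power[of I "\<lambda>i. t i ^ card I"] assms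
    by (simp add: prod_power_distrib)
  moreover have "0 \<le> (\<Sum>i\<in>I. t i ^ card I) / card I"
    using t by (intro divide_nonneg_nonneg sum_nonneg) auto
  moreover have "0 < card I" using assms by (simp add: card_gt_0_iff)
  ultimately show ?thesis
    using power_le_imp_le_base[of _ "card I - 1"] by simp
qed

text \<open>
  Superadditivity of the geometric mean, for the vectors with entries \<open>x\<^sub>i\<^sup>n\<close> and \<open>y\<^sub>i\<^sup>n - x\<^sub>i\<^sup>n\<close>:
  dividing both by their sum \<open>y\<^sub>i\<^sup>n\<close> turns them into two vectors whose arithmetic means add up
  to \<open>1\<close>, and each geometric mean is at most the arithmetic one.
\<close>

lemma prod_diff_powers_le:
  fixes x y :: "'i \<Rightarrow> real"
  assumes I: "finite I" "I \<noteq> {}"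
    and xy: "\<And>i. i \<in> I \<Longrightarrow> 0 \<le> x i" "\<And>i. i \<in> I \<Longrightarrow> x i \<le> y i"
  shows "(\<Prod>i\<in>I. y i ^ card I - x i ^ card I) \<le> ((\<Prod>i\<in>I. y i) - (\<Prod>i\<in>I. x i)) ^ card I"
proof (cases "\<forall>i\<in>I. 0 < y i")
  case False
  then obtain i where i: "i \<in> I" "y i = 0" "x i = 0"
    using xy by (metis antisym not_less order_trans)
  then have "(\<Prod>i\<in>I. y i ^ card I - x i ^ card I) = 0"
    using I by (intro prod_zero bexI[of _ i]) auto
  moreover have "(\<Prod>i\<in>I. x i) \<le> (\<Prod>i\<in>I. y i)"
    using xy by (intro prod_mono) auto
  ultimately show ?thesis by simp
next
  case True
  define n where "n = card I"
  have n: "n > 0" using I by (simp add: n_def card_gt_0_iff)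
  \<comment> \<open>The \<open>n\<close>-th roots of the factors, so that the mean inequality applies in the form with powers.\<close>
  define w where "w i = root n (y i ^ n - x i ^ n)" for i
  have ge: "y i ^ n - x i ^ n \<ge> 0" if "i \<in> I" for i
    using xy that by (simp add: power_mono)
  have w: "w i ^ n = y i ^ n - x i ^ n" "0 \<le> w i" if "i \<in> I" for i
    using ge[OF that] n by (auto simp: w_def)
  have "(\<Prod>i\<in>I. w i / y i) + (\<Prod>i\<in>I. x i / y i)
      \<le> (\<Sum>i\<in>I. (w i / y i) ^ n) / n + (\<Sum>i\<in>I. (x i / y i) ^ n) / n"
    unfolding n_def using I xy w True
    by (intro add_mono prod_le_mean_of_powers) (auto intro!: divide_nonneg_pos)
  also have "\<dots> = (\<Sum>i\<in>I. (w i / y i) ^ n + (x i / y i) ^ n) / n"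
    by (simp add: sum.distrib add_divide_distrib)
  also have "(\<Sum>i\<in>I. (w i / y i) ^ n + (x i / y i) ^ n) = (\<Sum>i\<in>I. 1)"
  proof (rule sum.cong[OF refl])
    fix i assume "i \<in> I"
    then show "(w i / y i) ^ n + (x i / y i) ^ n = 1"
      using True w(1)[OF \<open>i \<in> I\<close>] by (auto simp: power_divide add_divide_distrib[symmetric])
  qed
  also have "\<dots> / n = 1" using n by (simp add: n_def)
  finally have "((\<Prod>i\<in>I. w i) + (\<Prod>i\<in>I. x i)) / (\<Prod>i\<in>I. y i) \<le> 1"
    by (simp add: prod_dividef add_divide_distrib)
  moreover have "(\<Prod>i\<in>I. y i) > 0" using True by (intro prod_pos) auto
  ultimately have "(\<Prod>i\<in>I. w i) \<le> (\<Prod>i\<in>I. y i) - (\<Prod>i\<in>I. x i)"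
    by (simp add: divide_le_eq)
  then have "(\<Prod>i\<in>I. w i) ^ n \<le> ((\<Prod>i\<in>I. y i) - (\<Prod>i\<in>I. x i)) ^ n"
    using w by (intro power_mono prod_nonneg) auto
  also have "(\<Prod>i\<in>I. w i) ^ n = (\<Prod>i\<in>I. y i ^ n - x i ^ n)"
    unfolding prod_power_distrib by (rule prod.cong) (simp_all add: w)
  finally show ?thesis by (simp add: n_def)
qed

section \<open>Power coordinates on the unit cube\<close>

definition power_coords :: "real ^ 'd \<Rightarrow> real ^ 'd" where
  "power_coords x = (\<chi> j. x $ j ^ CARD('d))"

lemma power_coords_nth [simp]: "power_coords (x :: real ^ 'd) $ j = x $ j ^ CARD('d)"
  by (simp add: power_coords_def)

lemma power_coords_mono: "0 \<le> x \<Longrightarrow> x \<le> y \<Longrightarrow> power_coords x \<le> power_coords y"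
  by (auto simp: less_eq_vec_def intro!: power_mono)

lemma power_coords_onto_unit_cube:
  assumes "u \<in> {0..1 :: real ^ 'd}"
  obtains z where "z \<in> {0..1}" "power_coords z = u"
proof
  show "(\<chi> j. root CARD('d) (u $ j)) \<in> {0..1}"
    using assms by (auto simp: less_eq_vec_def)
  show "power_coords (\<chi> j. root CARD('d) (u $ j)) = u"
    using assms by (auto simp: vec_eq_iff less_eq_vec_def)
qed

lemma unit_cube_measure: "measure lebesgue {0..1 :: real ^ 'd} = 1"
  by (simp add: interval_cbox_cart content_cbox_if_cart interval_eq_empty_cart)

section \<open>Lower bound for bracketing covers\<close>

lemma bracket_image_measure_le:
  fixes x y :: "real ^ 'd"
  assumes "0 \<le> x" "x \<le> y" and \<delta>: "anchored_vol y - anchored_vol x \<le> \<delta>"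
  shows "measure lebesgue {power_coords x..power_coords y} \<le> \<delta> ^ CARD('d)"
proof -
  have xy: "0 \<le> x $ j" "x $ j \<le> y $ j" for j
    using assms by (auto simp: less_eq_vec_def)
  have "measure lebesgue {power_coords x..power_coords y}
      = (\<Prod>j\<in>UNIV. y $ j ^ CARD('d) - x $ j ^ CARD('d))"
    using power_coords_mono[OF assms(1,2)]
    by (auto simp: interval_cbox_cart content_cbox_if_cart interval_eq_empty_cart less_eq_vec_def
        not_less[symmetric])
  also have "\<dots> \<le> (anchored_vol y - anchored_vol x) ^ CARD('d)"
    unfolding anchored_vol_def using xy by (intro prod_diff_powers_le) auto
  also have "\<dots> \<le> \<delta> ^ CARD('d)"
    using \<delta> xy by (intro power_mono) (auto simp: anchored_vol_def intro!: prod_mono)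
  finally show ?thesis .
qed

text \<open>
  The images of the brackets in power coordinates still cover the unit cube, and each is
  small by the preceding lemma.
\<close>

lemma bracketing_cover_card_ge:
  fixes \<B> :: "(real ^ 'd) set set"
  assumes "bracketing_cover \<delta> \<B>"
  shows "1 \<le> real (card \<B>) * \<delta> ^ CARD('d)"
proof -
  have fin: "finite \<B>" and br: "\<And>B. B \<in> \<B> \<Longrightarrow> bracket \<delta> B" and un: "\<Union>\<B> = {0..1}"
    using assms by (auto simp: bracketing_cover_def)
  obtain x y where xy: "\<And>B. B \<in> \<B> \<Longrightarrow> 0 \<le> x B \<and> x B \<le> y B \<and> B = {x B..y B} \<and>
      anchored_vol (y B) - anchored_vol (x B) \<le> \<delta>"
  proof -
    have "\<forall>B\<in>\<B>. \<exists>p. 0 \<le> fst p \<and> fst p \<le> snd p \<and> B = {fst p..snd p} \<and>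
        anchored_vol (snd p) - anchored_vol (fst p) \<le> \<delta>"
      using br unfolding bracket_def by fastforce
    then obtain p where "\<forall>B\<in>\<B>. 0 \<le> fst (p B) \<and> fst (p B) \<le> snd (p B) \<and>
        B = {fst (p B)..snd (p B)} \<and> anchored_vol (snd (p B)) - anchored_vol (fst (p B)) \<le> \<delta>"
      unfolding bchoice_iff by blast
    then show ?thesis
      using that[of "\<lambda>B. fst (p B)" "\<lambda>B. snd (p B)"] by blast
  qed
  define Q where "Q B = {power_coords (x B)..power_coords (y B)}" for B
  have "{0..1} \<subseteq> (\<Union>B\<in>\<B>. Q B)"
  proof
    fix u :: "real ^ 'd" assume "u \<in> {0..1}"
    then obtain z where z: "z \<in> {0..1}" "power_coords z = u"
      by (rule power_coords_onto_unit_cube)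
    then obtain B where B: "B \<in> \<B>" "z \<in> B" using un by blast
    then have "z \<in> {x B..y B}" "0 \<le> x B" using xy by blast+
    then have "x B \<le> z" "z \<le> y B" "0 \<le> x B" by auto
    moreover have "0 \<le> z" using z by simp
    ultimately have "u \<in> Q B"
      unfolding Q_def z(2)[symmetric] by (auto intro: power_coords_mono)
    then show "u \<in> (\<Union>B\<in>\<B>. Q B)" using B by blast
  qed
  then have "measure lebesgue {0..1 :: real ^ 'd} \<le> measure lebesgue (\<Union>B\<in>\<B>. Q B)"
    using fin by (intro measure_mono_fmeasurable fmeasurable.finite_UN)
      (auto simp: Q_def interval_cbox_cart)
  also have "\<dots> \<le> (\<Sum>B\<in>\<B>. measure lebesgue (Q B))"
    using fin by (intro measure_UNION_le) (auto simp: Q_def interval_cbox_cart)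
  also have "\<dots> \<le> (\<Sum>B\<in>\<B>. \<delta> ^ CARD('d))"
    unfolding Q_def using xy by (intro sum_mono bracket_image_measure_le) auto
  finally show ?thesis by (simp add: unit_cube_measure)
qed

section \<open>Lower bound for covers by points\<close>

text \<open>
  The right-angled simplex with its right angle at \<open>a\<close> and legs of length \<open>r a\<^sub>j\<close> pointing in
  the negative coordinate directions. Being an affine image of the standard simplex, it
  inherits its measure from that one.
\<close>

definition corner_simplex :: "real ^ 'd \<Rightarrow> real \<Rightarrow> (real ^ 'd) set" where
  "corner_simplex a r =
     (\<lambda>v. a + (\<chi> j. (- r * a $ j) * v $ j)) ` (convex hull (insert 0 Basis))"

lemma std_simplex_lmeasurable:
  "convex hull (insert 0 Basis :: (real ^ 'd) set) \<in> lmeasurable"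
  by (intro lmeasurable_compact finite_imp_compact_convex_hull) simp

lemma corner_simplex_image:
  "corner_simplex a r = (+) a ` (\<lambda>v. \<chi> j. (- r * a $ j) * v $ j) ` (convex hull (insert 0 Basis))"
  by (simp add: corner_simplex_def image_image)

lemma corner_simplex_lmeasurable: "corner_simplex a r \<in> lmeasurable"
  unfolding corner_simplex_image
  by (intro measurable_translation measurable_stretch std_simplex_lmeasurable)

lemma corner_simplex_measure:
  fixes a :: "real ^ 'd"
  assumes "0 \<le> r" "0 \<le> a"
  shows "measure lebesgue (corner_simplex a r) = r ^ CARD('d) * (\<Prod>j\<in>UNIV. a $ j) / fact CARD('d)"
proof -
  have "measure lebesgue (convex hull (insert 0 Basis :: (real ^ 'd) set)) = 1 / fact CARD('d)"
    using content_std_simplex[where 'a = "real ^ 'd"]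
    by (simp add: measure_completion borel_compact finite_imp_compact_convex_hull)
  moreover have "\<bar>\<Prod>j\<in>UNIV. - r * a $ j\<bar> = r ^ CARD('d) * (\<Prod>j\<in>UNIV. a $ j)"
    using assms by (simp add: abs_prod abs_mult prod.distrib less_eq_vec_def cong: prod.cong)
  ultimately show ?thesis
    unfolding corner_simplex_image measure_translation measure_stretch[OF std_simplex_lmeasurable]
    by simp
qed

lemma mem_corner_simplex:
  fixes a u :: "real ^ 'd"
  assumes "0 < r" and a: "\<And>j. 0 < a $ j" and "u \<le> a"
    and sum: "(\<Sum>j\<in>UNIV. 1 - u $ j / a $ j) \<le> r"
  shows "u \<in> corner_simplex a r"
proof -
  define v :: "real ^ 'd" where "v = (\<chi> j. (1 - u $ j / a $ j) / r)"
  have le: "u $ j \<le> a $ j" for j using \<open>u \<le> a\<close> by (simp add: less_eq_vec_def)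
  have v0: "0 \<le> v $ j" for j
    using le[of j] a[of j] \<open>0 < r\<close> by (simp add: v_def)
  have "(\<Sum>j\<in>UNIV. v $ j) = (\<Sum>j\<in>UNIV. 1 - u $ j / a $ j) / r"
    by (simp add: v_def sum_divide_distrib)
  also have "\<dots> \<le> 1" using sum \<open>0 < r\<close> by simp
  finally have "(\<Sum>j\<in>UNIV. v $ j) \<le> 1" .
  moreover have "(\<Sum>i\<in>Basis. v \<bullet> i) = (\<Sum>j\<in>UNIV. v $ j)"
    by (simp add: Basis_vec_def sum.UNION_disjoint axis_eq_axis inner_axis UNION_singleton_eq_range
        sum.reindex inj_on_def)
  ultimately have "v \<in> convex hull (insert 0 Basis)"
    using v0 by (auto simp: std_simplex inner_axis dest!: axis_inverse)
  moreover have "u = a + (\<chi> j. (- r * a $ j) * v $ j)"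
    using a \<open>0 < r\<close> by (simp add: vec_eq_iff v_def field_simps less_imp_neq[symmetric])
  ultimately show ?thesis unfolding corner_simplex_def by blast
qed

text \<open>
  The mean inequality for the ratios \<open>z\<^sub>j / y\<^sub>j\<close> gives
  \<open>1 - \<delta> / V(y) \<le> V(z) / V(y) \<le> (\<Sum>\<^sub>j z\<^sub>j\<^sup>d / y\<^sub>j\<^sup>d) / d\<close>, which is the linear inequality that
  cuts out the simplex. It also covers the case \<open>V(y) < \<delta>\<close>, where the left side is negative.
\<close>

lemma below_point_mem_corner_simplex:
  fixes y z :: "real ^ 'd"
  assumes z: "0 \<le> z" "z \<le> y" and y: "0 < anchored_vol y" and "0 < \<delta>"
    and diff: "anchored_vol y - anchored_vol z \<le> \<delta>"
  shows "power_coords z \<in> corner_simplex (power_coords y) (real CARD('d) * \<delta> / anchored_vol y)"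
proof (rule mem_corner_simplex)
  let ?d = "CARD('d)"
  have zy: "0 \<le> z $ j" "z $ j \<le> y $ j" for j
    using z by (auto simp: less_eq_vec_def)
  have "y $ j \<noteq> 0" for j
  proof
    assume "y $ j = 0"
    then have "anchored_vol y = 0"
      unfolding anchored_vol_def by (intro prod_zero) auto
    then show False using y by simp
  qed
  then have y0: "0 < y $ j" for j
    using zy[of j] by (metis less_le order_trans)
  show "0 < real ?d * \<delta> / anchored_vol y" using y \<open>0 < \<delta>\<close> by simp
  show "0 < power_coords y $ j" for j using y0 by simp
  show "power_coords z \<le> power_coords y" using z by (rule power_coords_mono)
  have "1 - \<delta> / anchored_vol y \<le> anchored_vol z / anchored_vol y"
    using divide_right_mono[OF diff, of "anchored_vol y"] y by (simp add: diff_divide_distrib)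
  also have "\<dots> = (\<Prod>j\<in>UNIV. z $ j / y $ j)"
    by (simp add: anchored_vol_def prod_dividef)
  also have "\<dots> \<le> (\<Sum>j\<in>UNIV. (z $ j / y $ j) ^ ?d) / ?d"
    using zy y0 by (intro prod_le_mean_of_powers) (auto intro!: divide_nonneg_pos)
  finally have "real ?d * (1 - \<delta> / anchored_vol y) \<le> (\<Sum>j\<in>UNIV. (z $ j / y $ j) ^ ?d)"
    by (simp add: field_simps)
  then show "(\<Sum>j\<in>UNIV. 1 - power_coords z $ j / power_coords y $ j) \<le> real ?d * \<delta> / anchored_vol y"
    by (simp add: sum_subtractf power_divide algebra_simps)
qed

text \<open>
  The unit cube in power coordinates is covered by one set for each \<open>y\<close>: the corner simplex
  if \<open>V(y) > 0\<close>, and otherwise the whole box below \<open>y\<close>, which is degenerate. The second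
  kind includes \<open>y = 0\<close>, so that adjoining \<open>0\<close> to the cover costs nothing.
\<close>

lemma delta_cover_card_ge:
  fixes \<Gamma> :: "(real ^ 'd) set"
  assumes cover: "delta_cover \<delta> \<Gamma>" and "0 < \<delta>"
  shows "1 \<le> real (card \<Gamma>) * (real CARD('d) ^ CARD('d) * \<delta> ^ CARD('d) / fact CARD('d))"
proof -
  let ?d = "CARD('d)"
  let ?c = "real ?d ^ ?d * \<delta> ^ ?d / fact ?d"
  have fin: "finite \<Gamma>" and sub: "\<Gamma> \<subseteq> {0..1}"
    using cover by (auto simp: delta_cover_def)
  have vol: "(\<Prod>j\<in>UNIV. power_coords y $ j) = anchored_vol y ^ ?d" for y :: "real ^ 'd"
    by (simp add: anchored_vol_def prod_power_distrib)
  define S where "S y = (if anchored_vol y = 0 then {0..power_coords y}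
    else corner_simplex (power_coords y) (real ?d * \<delta> / anchored_vol y))" for y :: "real ^ 'd"
  have S: "S y \<in> lmeasurable" for y
    by (auto simp: S_def corner_simplex_lmeasurable interval_cbox_cart)
  have null: "measure lebesgue (S y) = 0" if "anchored_vol y = 0" for y
    using that vol[of y] by (simp add: S_def interval_cbox_cart content_cbox_if_cart)
  have S_le: "measure lebesgue (S y) \<le> ?c" if "y \<in> \<Gamma>" for y
  proof (cases "anchored_vol y = 0")
    case True
    then show ?thesis using null \<open>0 < \<delta>\<close> by simp
  next
    case False
    have y0: "0 \<le> y" using that sub by auto
    then have "0 \<le> anchored_vol y" by (auto simp: anchored_vol_def less_eq_vec_def intro: prod_nonneg)
    then have pos: "0 < anchored_vol y" using False by simp
    have "0 \<le> power_coords y" using y0 by (simp add: less_eq_vec_def)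
    then have "measure lebesgue (S y) = (real ?d * \<delta> / anchored_vol y) ^ ?d * anchored_vol y ^ ?d / fact ?d"
      using pos \<open>0 < \<delta>\<close> by (simp add: S_def corner_simplex_measure vol[simplified])
    also have "\<dots> = ?c" using pos by (simp add: power_divide power_mult_distrib)
    finally show ?thesis by simp
  qed
  have "{0..1} \<subseteq> (\<Union>y\<in>insert 0 \<Gamma>. S y)"
  proof
    fix u :: "real ^ 'd" assume "u \<in> {0..1}"
    then obtain z where z: "z \<in> {0..1}" "power_coords z = u"
      by (rule power_coords_onto_unit_cube)
    then obtain x y where xy: "x \<in> \<Gamma> \<union> {0}" "y \<in> \<Gamma> \<union> {0}" "x \<le> z" "z \<le> y"
      "anchored_vol y - anchored_vol x \<le> \<delta>"
      using cover unfolding delta_cover_def by blast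
    have x0: "0 \<le> x" and y0: "0 \<le> y" using xy sub by auto
    have "u \<in> S y"
    proof (cases "anchored_vol y = 0")
      case True
      then show ?thesis
        using z xy power_coords_mono[of z y] by (auto simp: S_def less_eq_vec_def)
    next
      case False
      moreover have "0 \<le> anchored_vol y"
        using y0 by (auto simp: anchored_vol_def less_eq_vec_def intro: prod_nonneg)
      moreover have "anchored_vol x \<le> anchored_vol z"
        using x0 xy(3) by (auto simp: anchored_vol_def less_eq_vec_def intro!: prod_mono)
      ultimately show ?thesis
        using below_point_mem_corner_simplex[of z y \<delta>] z xy \<open>0 < \<delta>\<close> by (simp add: S_def)
    qed
    then show "u \<in> (\<Union>y\<in>insert 0 \<Gamma>. S y)" using xy by blast
  qed
  then have "measure lebesgue {0..1 :: real ^ 'd} \<le> measure lebesgue (\<Union>y\<in>insert 0 \<Gamma>. S y)"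
    using fin S by (intro measure_mono_fmeasurable fmeasurable.finite_UN)
      (auto simp: interval_cbox_cart)
  also have "\<dots> \<le> (\<Sum>y\<in>insert 0 \<Gamma>. measure lebesgue (S y))"
    using fin S by (intro measure_UNION_le) auto
  also have "\<dots> = (\<Sum>y\<in>\<Gamma>. measure lebesgue (S y))"
    using fin null[of 0] by (cases "0 \<in> \<Gamma>") (auto simp: insert_absorb anchored_vol_def zero_power)
  also have "\<dots> \<le> (\<Sum>y\<in>\<Gamma>. ?c)" by (rule sum_mono) (rule S_le)
  finally show ?thesis by (simp add: unit_cube_measure)
qed

section \<open>Existence of finite covers\<close>

text \<open>
  The grid of mesh \<open>1/n\<close> works once \<open>d/n \<le> \<delta>\<close>: rounding the coordinates of \<open>z\<close> down and up
  gives two grid points that differ by at most \<open>1/n\<close> in each coordinate, and a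
  product of numbers in \<open>[0,1]\<close> changes by at most the sum of the changes of its factors.
\<close>

lemma delta_cover_exists:
  assumes "0 < \<delta>"
  shows "\<exists>\<Gamma> :: (real ^ 'd) set. delta_cover \<delta> \<Gamma>"
proof -
  obtain n where n: "real CARD('d) / \<delta> < real n" using reals_Archimedean2 by blast
  then have n0: "real n > 0" using assms by (smt (verit) divide_nonneg_pos of_nat_0_le_iff)
  define K where "K = (\<lambda>i. real i / n) ` {0..n}"
  define \<Gamma> :: "(real ^ 'd) set" where "\<Gamma> = {x. \<forall>j. x $ j \<in> K}"
  have mem_K: "of_int k / n \<in> K" if "0 \<le> k" "k \<le> int n" for k
    unfolding K_def using that by (intro image_eqI[of _ _ "nat k"]) auto
  have "\<Gamma> \<subseteq> vec_lambda ` (PiE UNIV (\<lambda>_. K))"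
  proof
    fix x assume "x \<in> \<Gamma>"
    then show "x \<in> vec_lambda ` (PiE UNIV (\<lambda>_. K))"
      by (intro image_eqI[of _ _ "vec_nth x"]) (auto simp: \<Gamma>_def)
  qed
  moreover have "finite (PiE (UNIV :: 'd set) (\<lambda>_. K))"
    by (intro finite_PiE) (auto simp: K_def)
  ultimately have "finite \<Gamma>" by (meson finite_surj)
  moreover have "\<Gamma> \<subseteq> {0..1}"
  proof -
    have "0 \<le> k \<and> k \<le> 1" if "k \<in> K" for k
      using that n0 by (auto simp: K_def divide_le_eq)
    then show ?thesis by (auto simp: \<Gamma>_def less_eq_vec_def)
  qed
  moreover have "\<exists>x\<in>\<Gamma> \<union> {0}. \<exists>y\<in>\<Gamma> \<union> {0}. x \<le> z \<and> z \<le> y \<and> anchored_vol y - anchored_vol x \<le> \<delta>"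
    if z: "z \<in> {0..1}" for z
  proof -
    define x y :: "real ^ 'd"
      where "x = (\<chi> j. of_int \<lfloor>n * z $ j\<rfloor> / n)" and "y = (\<chi> j. of_int \<lceil>n * z $ j\<rceil> / n)"
    have zj: "0 \<le> z $ j" "z $ j \<le> 1" for j using z by (auto simp: less_eq_vec_def)
    have nz: "0 \<le> n * z $ j" "n * z $ j \<le> n" for j
      using zj[of j] n0 by (auto simp: mult_left_le)
    have fc: "0 \<le> \<lfloor>n * z $ j\<rfloor>" "\<lfloor>n * z $ j\<rfloor> \<le> n" "0 \<le> \<lceil>n * z $ j\<rceil>" "\<lceil>n * z $ j\<rceil> \<le> n" for j
      using nz[of j] by linarith+
    have \<Gamma>: "x \<in> \<Gamma>" "y \<in> \<Gamma>"
      by (auto simp: \<Gamma>_def x_def y_def intro!: mem_K fc)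
    have "x \<le> z" "z \<le> y"
      using n0 by (auto simp: less_eq_vec_def x_def y_def divide_le_eq le_divide_eq mult.commute)
    have x01: "norm (x $ j) \<le> 1" and y01: "norm (y $ j) \<le> 1" for j
      using \<Gamma> \<open>\<Gamma> \<subseteq> {0..1}\<close> by (auto simp: less_eq_vec_def subset_iff)
    have step: "norm (y $ j - x $ j) \<le> 1 / n" for j
    proof -
      have "0 \<le> \<lceil>n * z $ j\<rceil> - \<lfloor>n * z $ j\<rfloor>" "\<lceil>n * z $ j\<rceil> - \<lfloor>n * z $ j\<rfloor> \<le> 1" by linarith+
      then have "\<bar>real_of_int \<lceil>n * z $ j\<rceil> - real_of_int \<lfloor>n * z $ j\<rfloor>\<bar> \<le> 1" by linarith
      then show ?thesis
        using n0 by (simp add: x_def y_def diff_divide_distrib[symmetric] divide_right_mono)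
    qed
    have "anchored_vol y - anchored_vol x \<le> norm (anchored_vol y - anchored_vol x)" by simp
    also have "\<dots> \<le> (\<Sum>j\<in>UNIV. norm (y $ j - x $ j))"
      unfolding anchored_vol_def using x01 y01 by (intro norm_prod_diff) auto
    also have "\<dots> \<le> (\<Sum>j\<in>(UNIV :: 'd set). 1 / n)" by (intro sum_mono step)
    also have "\<dots> \<le> \<delta>" using n n0 assms by (simp add: field_simps)
    finally show ?thesis using \<Gamma> \<open>x \<le> z\<close> \<open>z \<le> y\<close> by blast
  qed
  ultimately show ?thesis unfolding delta_cover_def by blast
qed

text \<open>
  All pairs of cover points that span a \<open>\<delta>\<close>-bracket give a bracketing cover, which reduces the
  existence question for brackets to that for points.
\<close>

lemma delta_cover_imp_bracketing_cover:
  fixes \<Gamma> :: "(real ^ 'd) set"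
  assumes "delta_cover \<delta> \<Gamma>"
  shows "\<exists>\<B> :: (real ^ 'd) set set. bracketing_cover \<delta> \<B>"
proof -
  let ?G = "\<Gamma> \<union> {0}"
  have G: "finite ?G" "?G \<subseteq> {0..1}"
    using assms by (auto simp: delta_cover_def less_eq_vec_def)
  define \<B> where "\<B> = {{x..y} | x y. x \<in> ?G \<and> y \<in> ?G \<and> x \<le> y \<and> anchored_vol y - anchored_vol x \<le> \<delta>}"
  have "\<B> \<subseteq> (\<lambda>(x, y). {x..y}) ` (?G \<times> ?G)"
    unfolding \<B>_def by auto
  then have "finite \<B>" using G(1) by (meson finite_SigmaI finite_surj)
  moreover have "\<forall>B\<in>\<B>. bracket \<delta> B"
    unfolding \<B>_def bracket_def using G(2) by blast
  moreover have "\<Union>\<B> = {0..1}"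
  proof (intro equalityI subsetI)
    fix z assume "z \<in> \<Union>\<B>"
    then obtain x y where "x \<in> ?G" "y \<in> ?G" "x \<le> z" "z \<le> y" unfolding \<B>_def by fastforce
    moreover have "0 \<le> x" "y \<le> 1" using calculation G(2) by auto
    ultimately show "z \<in> {0..1}" by (auto intro: order_trans)
  next
    fix z :: "real ^ 'd" assume "z \<in> {0..1}"
    then obtain x y where "x \<in> ?G" "y \<in> ?G" "x \<le> z" "z \<le> y" "anchored_vol y - anchored_vol x \<le> \<delta>"
      using assms unfolding delta_cover_def by blast
    moreover have "x \<le> y" using calculation by order
    ultimately have "{x..y} \<in> \<B>" "z \<in> {x..y}" unfolding \<B>_def by auto
    then show "z \<in> \<Union>\<B>" by blast
  qed
  ultimately show ?thesis unfolding bracketing_cover_def by blast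
qed

section \<open>The lower bounds\<close>

theorem theorem1p1:
  fixes \<delta> :: real
  assumes "0 < \<delta>" and "\<delta> \<le> 1"
  shows "int (bracketing_number TYPE('d::finite) \<delta>) \<ge> \<lceil>\<delta> powi (- int CARD('d))\<rceil> \<and>
         int (covering_number TYPE('d) \<delta>) \<ge>
           \<lceil>fact CARD('d) / real CARD('d) ^ CARD('d) * \<delta> powi (- int CARD('d))\<rceil>"
proof
  let ?d = "CARD('d)"
  have powi: "\<delta> powi (- int ?d) = 1 / \<delta> ^ ?d"
    by (simp add: power_int_minus divide_inverse)
  obtain \<Gamma>\<^sub>0 :: "(real ^ 'd) set" where \<Gamma>\<^sub>0: "delta_cover \<delta> \<Gamma>\<^sub>0"
    using delta_cover_exists[OF assms(1)] by blast
  then have "\<exists>n. \<exists>\<B> :: (real ^ 'd) set set. bracketing_cover \<delta> \<B> \<and> card \<B> = n"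
    using delta_cover_imp_bracketing_cover by blast
  then have "\<exists>\<B> :: (real ^ 'd) set set. bracketing_cover \<delta> \<B> \<and> card \<B> = bracketing_number TYPE('d) \<delta>"
    unfolding bracketing_number_def by (rule LeastI_ex)
  then obtain \<B> :: "(real ^ 'd) set set"
    where \<B>: "bracketing_cover \<delta> \<B>" "card \<B> = bracketing_number TYPE('d) \<delta>" by blast
  have "\<delta> powi (- int ?d) \<le> real (bracketing_number TYPE('d) \<delta>)"
    using bracketing_cover_card_ge[OF \<B>(1)] assms(1) by (simp add: powi \<B>(2) divide_le_eq)
  then show "int (bracketing_number TYPE('d) \<delta>) \<ge> \<lceil>\<delta> powi (- int ?d)\<rceil>"
    by (simp add: ceiling_le_iff)
  have "\<exists>n. \<exists>\<Gamma> :: (real ^ 'd) set. delta_cover \<delta> \<Gamma> \<and> card \<Gamma> = n"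
    using \<Gamma>\<^sub>0 by blast
  then have "\<exists>\<Gamma> :: (real ^ 'd) set. delta_cover \<delta> \<Gamma> \<and> card \<Gamma> = covering_number TYPE('d) \<delta>"
    unfolding covering_number_def by (rule LeastI_ex)
  then obtain \<Gamma> :: "(real ^ 'd) set"
    where \<Gamma>: "delta_cover \<delta> \<Gamma>" "card \<Gamma> = covering_number TYPE('d) \<delta>" by blast
  have "fact ?d / real ?d ^ ?d * \<delta> powi (- int ?d) \<le> real (covering_number TYPE('d) \<delta>)"
    using delta_cover_card_ge[OF \<Gamma>(1) assms(1)] assms(1) by (simp add: powi \<Gamma>(2) field_simps)
  then show "int (covering_number TYPE('d) \<delta>)
      \<ge> \<lceil>fact ?d / real ?d ^ ?d * \<delta> powi (- int ?d)\<rceil>"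
    by (simp add: ceiling_le_iff)
qed

end
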